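(* The eigenspace $E_{-1}=\{v\in\ell_1\mid L_{T,1}(v)=-v\}$ of $\lambda=-1$ for $L_{T,1}\colon\ell_1\to\ell_1$ coincides with the closed linear span in $\ell_1$ of the vectors $\{v_i\mid\mathcal{C}_i\text{ is a cycle of even length}\}$, where for a cycle $\mathcal{C}_i=\{n_1,\dots,n_l\}$ of even length $l$ one sets $v_i=\sum_{j=1}^{l}(-1)^{j-1}e_{n_j}$.
   Context: $\mathbb{N}^*=\{1,2,3,\dots\}$. The Collatz map $T\colon\mathbb{N}^*\to\mathbb{N}^*$ is $T(n)=n/2$ for $n$ even and $T(n)=(3n+1)/2$ for $n$ odd. $\ell_1$ has unit vectors $(e_n)_{n\in\mathbb{N}^*}$, and $L_{T,1}\colon\ell_1\to\ell_1$ is the bounded linear operator $L_{T,1}\left(\sum_n x_ne_n\right)=\sum_n x_ne_{T(n)}$. A cycle is a finite set $\mathcal{C}=\{n_1,\dots,n_l\}\subset\mathbb{N}^*$ of $l$ distinct elements, enumerated so that $T(n_j)=n_{j+1}$ for $j<l$ and $T(n_l)=n_1$; its length is $l$. The at most countably many cycles are listed as $\mathcal{C}_1,\mathcal{C}_2,\dots$, and for each a starting element $n_1$ is fixed. *)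

theory Defs
  imports "HOL-Analysis.Analysis"
begin

section \<open>The space \<open>\<ell>\<^sub>1\<close> over \<open>\<nat>\<^sup>* = {1, 2, \<dots>}\<close>\<close>

text \<open>
  A sequence indexed by the positive integers is a function on \<^typ>\<open>nat\<close> that vanishes at \<open>0\<close>.
  The scalars form a real normed field, which is the field of real or of complex numbers once
  completeness (class \<^class>\<open>banach\<close>) is imposed, as it is for the operator below.
\<close>

typedef (overloaded) 'a ell1 =
  "{x :: nat \<Rightarrow> 'a::real_normed_field. x 0 = 0 \<and> summable (\<lambda>n. norm (x n))}"
  morphisms coord Abs_ell1
  by (rule exI[of _ "\<lambda>_. 0"]) simp

setup_lifting type_definition_ell1

lemma coord_0 [simp]: "coord x 0 = 0"
  by transfer simp

lemma summable_norm_coord [simp]: "summable (\<lambda>n. norm (coord x n))"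
  by transfer simp

lemma ell1_eqI: "(\<And>n. coord x n = coord y n) \<Longrightarrow> x = y"
  by transfer auto

instantiation ell1 :: (real_normed_field) real_normed_vector
begin

lift_definition zero_ell1 :: "'a ell1" is "\<lambda>_. 0"
  by simp

lift_definition plus_ell1 :: "'a ell1 \<Rightarrow> 'a ell1 \<Rightarrow> 'a ell1" is "\<lambda>x y n. x n + y n"
proof (intro conjI)
  fix x y :: "nat \<Rightarrow> 'a"
  assume *: "x 0 = 0 \<and> summable (\<lambda>n. norm (x n))" "y 0 = 0 \<and> summable (\<lambda>n. norm (y n))"
  then show "x 0 + y 0 = 0" by simp
  have "summable (\<lambda>n. norm (x n) + norm (y n))"
    using * by (intro summable_add) auto
  then show "summable (\<lambda>n. norm (x n + y n))"
    by (rule summable_comparison_test') (simp add: norm_triangle_ineq)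
qed

lift_definition uminus_ell1 :: "'a ell1 \<Rightarrow> 'a ell1" is "\<lambda>x n. - x n"
  by simp

definition minus_ell1 :: "'a ell1 \<Rightarrow> 'a ell1 \<Rightarrow> 'a ell1" where
  "minus_ell1 x y = x + - y"

lift_definition scaleR_ell1 :: "real \<Rightarrow> 'a ell1 \<Rightarrow> 'a ell1" is "\<lambda>r x n. r *\<^sub>R x n"
  by (simp add: summable_mult)

definition norm_ell1 :: "'a ell1 \<Rightarrow> real" where
  "norm_ell1 x = (\<Sum>n. norm (coord x n))"

definition sgn_ell1 :: "'a ell1 \<Rightarrow> 'a ell1" where
  "sgn_ell1 x = scaleR (inverse (norm x)) x"

definition dist_ell1 :: "'a ell1 \<Rightarrow> 'a ell1 \<Rightarrow> real" where
  "dist_ell1 x y = norm (x - y)"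

definition uniformity_ell1 :: "('a ell1 \<times> 'a ell1) filter" where
  "uniformity_ell1 = (INF e\<in>{0<..}. principal {(x, y). dist x y < e})"

definition open_ell1 :: "'a ell1 set \<Rightarrow> bool" where
  "open_ell1 U \<longleftrightarrow> (\<forall>x\<in>U. \<forall>\<^sub>F (x', y) in uniformity. x' = x \<longrightarrow> y \<in> U)"

instance
proof
  fix x y z :: "'a ell1" and r s :: real
  show "x + y + z = x + (y + z)" "x + y = y + x" "0 + x = x" "- x + x = 0"
    by (transfer; simp add: algebra_simps)+
  show "x - y = x + - y" by (rule minus_ell1_def)
  show "r *\<^sub>R (x + y) = r *\<^sub>R x + r *\<^sub>R y" "(r + s) *\<^sub>R x = r *\<^sub>R x + s *\<^sub>R x"
    "r *\<^sub>R s *\<^sub>R x = (r * s) *\<^sub>R x" "1 *\<^sub>R x = x"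
    by (transfer; simp add: algebra_simps)+
  show "dist x y = norm (x - y)" by (rule dist_ell1_def)
  show "sgn x = inverse (norm x) *\<^sub>R x" by (rule sgn_ell1_def)
  show "uniformity = (INF e\<in>{0<..}. principal {(x, y :: 'a ell1). dist x y < e})"
    by (rule uniformity_ell1_def)
  show "open U \<longleftrightarrow> (\<forall>x\<in>U. \<forall>\<^sub>F (x', y) in uniformity. x' = x \<longrightarrow> y \<in> U)" for U :: "'a ell1 set"
    by (rule open_ell1_def)
  show "norm x = 0 \<longleftrightarrow> x = 0"
  proof -
    have "norm x = 0 \<longleftrightarrow> (\<forall>n. coord x n = 0)"
      unfolding norm_ell1_def by (subst suminf_eq_zero_iff) auto
    also have "\<dots> \<longleftrightarrow> x = 0"
      by transfer auto
    finally show ?thesis .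
  qed
  show "norm (x + y) \<le> norm x + norm y"
  proof -
    have "(\<Sum>n. norm (coord (x + y) n)) \<le> (\<Sum>n. norm (coord x n) + norm (coord y n))"
      by (intro suminf_le summable_norm_coord summable_add)
         (simp add: plus_ell1.rep_eq norm_triangle_ineq)
    then show ?thesis
      by (simp add: norm_ell1_def suminf_add)
  qed
  show "norm (r *\<^sub>R x) = \<bar>r\<bar> * norm x"
    by (simp add: norm_ell1_def scaleR_ell1.rep_eq suminf_mult)
qed

end

lemma coord_zero [simp]: "coord 0 n = 0"
  by transfer simp

lemma coord_add [simp]: "coord (x + y) n = coord x n + coord y n"
  by transfer simp

lemma coord_uminus [simp]: "coord (- x) n = - coord x n"
  by transfer simp

lemma coord_diff [simp]: "coord (x - y) n = coord x n - coord y n"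
  unfolding minus_ell1_def coord_add coord_uminus by (rule add_uminus_conv_diff)

lemma coord_scaleR [simp]: "coord (r *\<^sub>R x) n = r *\<^sub>R coord x n"
  by transfer simp

lemma sum_norm_coord_le: "(\<Sum>n<k. norm (coord x n)) \<le> norm x"
  unfolding norm_ell1_def by (rule sum_le_suminf) auto

lemma norm_coord_le: "norm (coord x n) \<le> norm x"
  using sum_le_suminf[of "\<lambda>n. norm (coord x n)" "{n}"] by (simp add: norm_ell1_def)

instance ell1 :: ("{real_normed_field, banach}") banach
proof
  fix X :: "nat \<Rightarrow> 'a ell1"
  assume X: "Cauchy X"
  have "Cauchy (\<lambda>i. coord (X i) n)" for n
  proof (rule metric_CauchyI)
    fix e :: real
    assume "e > 0"
    then obtain M where "\<And>i j. i \<ge> M \<Longrightarrow> j \<ge> M \<Longrightarrow> dist (X i) (X j) < e"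
      using metric_CauchyD[OF X] by blast
    moreover have "dist (coord (X i) n) (coord (X j) n) \<le> dist (X i) (X j)" for i j
      using norm_coord_le[of "X i - X j" n] by (simp add: dist_norm)
    ultimately have "dist (coord (X i) n) (coord (X j) n) < e" if "i \<ge> M" "j \<ge> M" for i j
      using le_less_trans that by blast
    then show "\<exists>M. \<forall>i\<ge>M. \<forall>j\<ge>M. dist (coord (X i) n) (coord (X j) n) < e"
      by blast
  qed
  then have "convergent (\<lambda>i. coord (X i) n)" for n
    by (rule Cauchy_convergent)
  then obtain y where y: "\<And>n. (\<lambda>i. coord (X i) n) \<longlonglongrightarrow> y n"
    unfolding convergent_def by metis
  have bound: "\<exists>M. \<forall>i\<ge>M. \<forall>k. (\<Sum>n<k. norm (coord (X i) n - y n)) \<le> e" if "e > 0" for e :: real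
  proof -
    obtain M where M: "\<And>i j. i \<ge> M \<Longrightarrow> j \<ge> M \<Longrightarrow> dist (X i) (X j) < e"
      using metric_CauchyD[OF X \<open>e > 0\<close>] by blast
    have "(\<Sum>n<k. norm (coord (X i) n - y n)) \<le> e" if "i \<ge> M" for i k
    proof (rule LIMSEQ_le_const2)
      show "(\<lambda>j. \<Sum>n<k. norm (coord (X i) n - coord (X j) n)) \<longlonglongrightarrow>
              (\<Sum>n<k. norm (coord (X i) n - y n))"
        by (intro tendsto_intros y)
      have "(\<Sum>n<k. norm (coord (X i) n - coord (X j) n)) \<le> e" if "j \<ge> M" for j
        using sum_norm_coord_le[where x = "X i - X j" and k = k] M[OF \<open>i \<ge> M\<close> that]
        by (simp add: dist_norm)
      then show "\<exists>N. \<forall>j\<ge>N. (\<Sum>n<k. norm (coord (X i) n - coord (X j) n)) \<le> e"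
        by blast
    qed
    then show ?thesis by blast
  qed
  have y0: "y 0 = 0"
    using LIMSEQ_unique[OF y[of 0]] by simp
  obtain M where M: "\<And>i k. i \<ge> M \<Longrightarrow> (\<Sum>n<k. norm (coord (X i) n - y n)) \<le> 1"
    using bound[OF zero_less_one] by blast
  have "summable (\<lambda>n. norm (coord (X M) n - y n))"
    by (rule summableI_nonneg_bounded[where x = 1]) (simp_all add: M)
  then have "summable (\<lambda>n. norm (coord (X M) n) + norm (coord (X M) n - y n))"
    by (rule summable_add[OF summable_norm_coord])
  moreover have "norm (norm (y n)) \<le> norm (coord (X M) n) + norm (coord (X M) n - y n)" for n
    using norm_triangle_sub[of "y n" "coord (X M) n"] by (simp add: norm_minus_commute)
  ultimately have sy: "summable (\<lambda>n. norm (y n))"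
    by (rule summable_comparison_test')
  define Y where "Y = Abs_ell1 y"
  have Y: "coord Y n = y n" for n
    using y0 sy by (simp add: Y_def Abs_ell1_inverse)
  have "X \<longlonglongrightarrow> Y"
  proof (rule metric_LIMSEQ_I)
    fix e :: real
    assume "e > 0"
    then obtain M where M: "\<And>i k. i \<ge> M \<Longrightarrow> (\<Sum>n<k. norm (coord (X i) n - y n)) \<le> e / 2"
      using bound[OF half_gt_zero] by blast
    have "dist (X i) Y < e" if "i \<ge> M" for i
    proof -
      have "norm (X i - Y) \<le> e / 2"
        unfolding norm_ell1_def
      proof (rule suminf_le_const)
        show "(\<Sum>n<k. norm (coord (X i - Y) n)) \<le> e / 2" for k
          using M[OF that] by (simp add: Y)
      qed (rule summable_norm_coord)
      then show ?thesis
        using \<open>e > 0\<close> by (simp add: dist_norm)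
    qed
    then show "\<exists>M. \<forall>i\<ge>M. dist (X i) Y < e" by blast
  qed
  then show "convergent X"
    by (auto simp: convergent_def)
qed

text \<open>Multiplication by scalars of the field \<^typ>\<open>'a\<close>; linear spans are formed with respect to it.\<close>

lift_definition scale_ell1 :: "'a::real_normed_field \<Rightarrow> 'a ell1 \<Rightarrow> 'a ell1"  (infixr \<open>*\<^sub>E\<close> 75)
  is "\<lambda>c x n. c * x n"
  by (simp add: norm_mult summable_mult)

lemma coord_scale [simp]: "coord (c *\<^sub>E x) n = c * coord x n"
  by transfer simp

lemma norm_scale_ell1: "norm (c *\<^sub>E x) = norm c * norm x"
  by (simp add: norm_ell1_def norm_mult suminf_mult)

interpretation ell1: vector_space scale_ell1
  by unfold_locales (rule ell1_eqI, simp add: distrib_left distrib_right mult.assoc)+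

text \<open>The unit vectors; only the indices \<open>n \<ge> 1\<close> are meaningful.\<close>

lift_definition unit_vec :: "nat \<Rightarrow> 'a::real_normed_field ell1"
  is "\<lambda>n m. if n = m \<and> 0 < n then 1 else 0"
proof (intro conjI)
  fix n :: nat
  show "summable (\<lambda>m. norm (if n = m \<and> 0 < n then 1 else 0 :: 'a))"
    by (rule summable_finite[of "{n}"]) auto
qed auto

lemma coord_unit_vec: "coord (unit_vec n) m = (if n = m \<and> 0 < n then 1 else 0)"
  by transfer simp

lemma norm_unit_vec: "n \<ge> 1 \<Longrightarrow> norm (unit_vec n) = 1"
  unfolding norm_ell1_def coord_unit_vec
  by (subst suminf_finite[where N = "{n}"]) auto

lemma coord_summable_on: "(\<lambda>n. norm (coord x n)) summable_on A"
  by (rule summable_on_subset_banach[where A = UNIV]) (auto simp: summable_on_UNIV_nonneg_real_iff)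


section \<open>The Collatz map, its operator and its cycles\<close>

definition collatz :: "nat \<Rightarrow> nat" where
  "collatz n = (if even n then n div 2 else (3 * n + 1) div 2)"

lemma collatz_pos: "n \<ge> 1 \<Longrightarrow> collatz n \<ge> 1"
  unfolding collatz_def by presburger

definition collatz_op :: "'a::{real_normed_field, banach} ell1 \<Rightarrow> 'a ell1" where
  "collatz_op x = (\<Sum>\<^sub>\<infinity>n\<in>{1..}. coord x n *\<^sub>E unit_vec (collatz n))"

text \<open>The series defining the operator converges for every \<open>x\<close>.\<close>

lemma collatz_op_has_sum:
  "((\<lambda>n. coord x n *\<^sub>E unit_vec (collatz n)) has_sum collatz_op x) {1..}"
proof -
  have "(\<lambda>n. norm (coord x n *\<^sub>E unit_vec (collatz n))) summable_on {1..}
        \<longleftrightarrow> (\<lambda>n. norm (coord x n)) summable_on {1..}"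
    by (intro summable_on_cong) (simp add: norm_scale_ell1 norm_unit_vec[OF collatz_pos] del: One_nat_def)
  then have "(\<lambda>n. norm (coord x n *\<^sub>E unit_vec (collatz n))) summable_on {1..}"
    by (simp only: coord_summable_on)
  then have "(\<lambda>n. coord x n *\<^sub>E unit_vec (collatz n)) summable_on {1..}"
    by (rule abs_summable_summable)
  then show ?thesis
    unfolding collatz_op_def by (rule has_sum_infsum)
qed

text \<open>\<open>n 1, \<dots>, n l\<close> is an enumeration, in the order of the dynamics, of the cycle \<open>C\<close> of length \<open>l\<close>.\<close>

definition enumerates_cycle :: "(nat \<Rightarrow> nat) \<Rightarrow> nat \<Rightarrow> nat set \<Rightarrow> bool" where
  "enumerates_cycle n l C \<longleftrightarrow>
     1 \<le> l \<and> inj_on n {1..l} \<and> C = n ` {1..l} \<and> C \<subseteq> {1..} \<and>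
     (\<forall>j\<in>{1..<l}. collatz (n j) = n (j + 1)) \<and> collatz (n l) = n 1"

definition is_cycle :: "nat set \<Rightarrow> bool" where
  "is_cycle C \<longleftrightarrow> (\<exists>n l. enumerates_cycle n l C)"

definition cycle_vec :: "(nat \<Rightarrow> nat) \<Rightarrow> nat \<Rightarrow> 'a::real_normed_field ell1" where
  "cycle_vec n l = (\<Sum>j=1..l. (- 1) ^ (j - 1) *\<^sub>E unit_vec (n j))"

end

theory Submission
  imports Defs
begin

text \<open>
  In coordinates the equation \<open>L v = - v\<close> says that for every \<open>m\<close> the coordinates of \<open>v\<close> over the
  finite fibre of \<open>m\<close> under the Collatz map sum to \<open>- v m\<close>. Each condition is linear and
  continuous in \<open>v\<close>, so the eigenspace is a closed subspace. It contains the vectors of the even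
  cycles, since moving one step along such a cycle flips the sign; hence it contains their closed
  span.

  For the other inclusion let \<open>v\<close> be an eigenvector. By the triangle inequality \<open>\<bar>v m\<bar>\<close> is at most
  the sum of \<open>\<bar>v k\<bar>\<close> over the fibre of \<open>m\<close>. The fibres partition the positive integers, so both
  sides have the same total over all \<open>m\<close>, the norm of \<open>v\<close>, and equality holds for every \<open>m\<close>
  (\<open>eigen_norm_fibre\<close>). The mass \<open>\<bar>v\<bar>\<close> is thus carried along by the map without loss, which leaves
  no room for mass outside the periodic points: it never decreases along an orbit, so, being
  summable, it forces the orbit of a point of positive mass to be finite; and if such an orbit
  entered a cycle from outside, mass would flow into the cycle that cannot get out again, although
  the mass along a cycle is constant (\<open>conserved_mass_periodic\<close>).

  On a cycle, each point therefore receives mass from its predecessor on the cycle only, so that \<open>v\<close>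
  changes sign at each step (\<open>eigen_alternates_at_periodic\<close>). Going once around an odd cycle gives
  \<open>v = - v\<close>, that is, zero; on an even cycle \<open>v\<close> is a multiple of the cycle vector. As distinct
  cycles are disjoint, the finite sums of these multiples are restrictions of \<open>v\<close>. Those over the
  even cycles that meet \<open>{..<N}\<close> differ from \<open>v\<close> by at most the tail of \<open>v\<close> from \<open>N\<close> on, and so
  converge to \<open>v\<close>.
\<close>

section \<open>The eigenvalue equation in coordinates\<close>

text \<open>
  The point \<open>0\<close>, fixed by \<^const>\<open>collatz\<close> as a function on \<^typ>\<open>nat\<close>, does not belong to the
  domain of the Collatz map.
\<close>

abbreviation collatz_fibre :: "nat \<Rightarrow> nat set" where
  "collatz_fibre m \<equiv> {k. 0 < k \<and> collatz k = m}"

lemma finite_collatz_fibre: "finite (collatz_fibre m)"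
proof (rule finite_subset)
  show "collatz_fibre m \<subseteq> {..2 * m}"
    unfolding collatz_def by auto
qed simp

lemma bounded_linear_coord: "bounded_linear (\<lambda>x. coord x n)"
  by (rule bounded_linear_intro[where K = 1]) (simp_all add: norm_coord_le)

lemma coord_sum: "coord (sum f A) k = (\<Sum>i\<in>A. coord (f i) k)"
  by (induction A rule: infinite_finite_induct) auto

lemma coord_collatz_op: "coord (collatz_op v) m = (\<Sum>k\<in>collatz_fibre m. coord v k)"
proof -
  have "((\<lambda>k. coord (coord v k *\<^sub>E unit_vec (collatz k)) m) has_sum coord (collatz_op v) m) {1..}"
    by (rule has_sum_bounded_linear[OF bounded_linear_coord collatz_op_has_sum])
  also have "?this \<longleftrightarrow> ((\<lambda>k. coord v k) has_sum coord (collatz_op v) m) (collatz_fibre m)"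
  proof (rule has_sum_cong_neutral)
    fix k assume "k \<in> {1..} \<inter> collatz_fibre m"
    then show "coord (coord v k *\<^sub>E unit_vec (collatz k)) m = coord v k"
      using collatz_pos[of k] by (auto simp: coord_unit_vec)
  qed (auto simp: coord_unit_vec Suc_le_eq)
  finally show ?thesis
    using has_sum_finite[OF finite_collatz_fibre] has_sum_unique by blast
qed

lemma eigen_iff_fibre_sums:
  "collatz_op v = - v \<longleftrightarrow> (\<forall>m. (\<Sum>k\<in>collatz_fibre m. coord v k) = - coord v m)"
  by (metis coord_collatz_op coord_uminus ell1_eqI)

text \<open>
  The eigenspace is cut out by equations between finite sums of coordinates, each of which is
  linear and continuous in \<open>v\<close>.
\<close>

lemma subspace_eigenspace:
  "ell1.subspace {v :: 'a::{real_normed_field, banach} ell1. collatz_op v = - v}"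
  by (rule ell1.subspaceI)
     (simp_all add: eigen_iff_fibre_sums sum.distrib sum_distrib_left[symmetric])

lemma closed_eigenspace: "closed {v :: 'a::{real_normed_field, banach} ell1. collatz_op v = - v}"
  unfolding eigen_iff_fibre_sums
  by (intro closed_Collect_all closed_Collect_eq continuous_intros
      linear_continuous_on bounded_linear_coord)

lemma coord_cycle_vec:
  assumes "enumerates_cycle n l C"
  shows "coord (cycle_vec n l) m = (\<Sum>j=1..l. if n j = m then (- 1) ^ (j - 1) else 0)"
proof -
  have "n j \<noteq> 0" if "j \<in> {1..l}" for j
    using assms that by (force simp: enumerates_cycle_def)
  then show ?thesis
    unfolding cycle_vec_def coord_sum
    by (intro sum.cong) (auto simp: coord_unit_vec)
qed

lemma coord_cycle_vec_enum:
  assumes "enumerates_cycle n l C" "j \<in> {1..l}"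
  shows "coord (cycle_vec n l) (n j) = (- 1) ^ (j - 1)"
proof -
  have "inj_on n {1..l}"
    using assms(1) by (simp add: enumerates_cycle_def)
  then have "n i = n j \<longleftrightarrow> i = j" if "i \<in> {1..l}" for i
    using inj_on_eq_iff assms(2) that by fast
  then have "coord (cycle_vec n l) (n j) = (\<Sum>i=1..l. if i = j then (- 1) ^ (i - 1) else 0 :: 'a)"
    unfolding coord_cycle_vec[OF assms(1)] by (intro sum.cong) auto
  then show ?thesis
    using assms(2) by simp
qed

lemma coord_cycle_vec_outside:
  assumes "enumerates_cycle n l C" "k \<notin> C"
  shows "coord (cycle_vec n l) k = 0"
  using assms unfolding coord_cycle_vec[OF assms(1)]
  by (intro sum.neutral) (auto simp: enumerates_cycle_def)

text \<open>
  Summing over the fibre of \<open>m\<close> turns the coefficient at \<open>n j\<close> into one at \<open>n (j + 1)\<close>, which has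
  the opposite sign. Evenness enters where the cycle closes up: the coefficient \<open>-1\<close> at
  \<open>n l\<close> moves to \<open>n 1\<close>, where the vector has coefficient \<open>1\<close>.
\<close>

lemma even_cycle_vec_eigen:
  assumes enum: "enumerates_cycle n l C" and "even l"
  shows "collatz_op (cycle_vec n l :: 'a::{real_normed_field, banach} ell1) = - cycle_vec n l"
  unfolding eigen_iff_fibre_sums
proof
  fix m
  obtain l' where l: "l = Suc l'"
    using enum by (cases l) (auto simp: enumerates_cycle_def)
  have pos: "1 \<le> n j" if "j \<in> {1..l}" for j
    using enum that by (force simp: enumerates_cycle_def)
  have step: "collatz (n j) = n (Suc j)" if "j \<in> {1..l'}" for j
    using enum that by (auto simp: enumerates_cycle_def l)
  have last: "collatz (n l) = n 1"
    using enum by (auto simp: enumerates_cycle_def)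
  have "(\<Sum>k\<in>collatz_fibre m. coord (cycle_vec n l :: 'a ell1) k) =
        (\<Sum>j=1..l. \<Sum>k\<in>collatz_fibre m. if n j = k then (- 1) ^ (j - 1) else 0)"
    unfolding coord_cycle_vec[OF enum] by (rule sum.swap)
  also have "\<dots> = (\<Sum>j=1..l. if collatz (n j) = m then (- 1) ^ (j - 1) else 0)"
    by (intro sum.cong refl, subst sum.delta'[OF finite_collatz_fibre]) (use pos in \<open>auto simp: Suc_le_eq\<close>)
  also have "\<dots> = (\<Sum>j=1..l'. if n (Suc j) = m then (- 1) ^ (j - 1) else 0)
                 + (if n 1 = m then (- 1) ^ l' else 0)"
    using step last by (simp add: l)
  also have "(\<Sum>j=1..l'. if n (Suc j) = m then (- 1) ^ (j - 1) else 0 :: 'a)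
      = (\<Sum>j=1..l'. - (if n (Suc j) = m then (- 1) ^ (Suc j - 1) else 0))"
    by (intro sum.cong) (auto simp: power_eq_if)
  also have "\<dots> = - (\<Sum>j=Suc 1..l. if n j = m then (- 1) ^ (j - 1) else 0)"
    unfolding l sum.shift_bounds_cl_Suc_ivl sum_negf by simp
  also have "(- 1 :: 'a) ^ l' = - 1"
    using \<open>even l\<close> by (simp add: l)
  also have "- (\<Sum>j=Suc 1..l. if n j = m then (- 1) ^ (j - 1) else 0)
      + (if n 1 = m then - 1 else 0 :: 'a)
      = - (\<Sum>j=1..l. if n j = m then (- 1) ^ (j - 1) else 0)"
    by (subst (2) sum.atLeast_Suc_atMost) (auto simp: l)
  finally show "(\<Sum>k\<in>collatz_fibre m. coord (cycle_vec n l :: 'a ell1) k)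
      = - coord (cycle_vec n l) m"
    unfolding coord_cycle_vec[OF enum] .
qed


section \<open>Periodicity of points whose mass does not decrease along orbits\<close>

lemma mass_mono_funpow:
  fixes a :: "'b \<Rightarrow> 'c::preorder"
  assumes "\<And>x. a x \<le> a (T x)"
  shows "a x \<le> a ((T ^^ k) x)"
  by (induction k) (auto intro: order_trans assms)

text \<open>
  The orbit of \<open>x\<close> stays in the finite set of points at least as heavy as \<open>x\<close>, so it is eventually
  periodic. If its preperiod is positive, the first periodic point of the orbit has two distinct
  preimages in the orbit: \<open>p\<close> before the cycle and \<open>q\<close> on it. Then \<open>a p + a q \<le> a (T p) \<le> a q\<close>, the
  last step by following the cycle from \<open>T p\<close> to \<open>q\<close>. This contradicts \<open>a p \<ge> a x > 0\<close>.
\<close>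

lemma conserved_mass_periodic:
  fixes a :: "'b \<Rightarrow> real"
  assumes mono: "\<And>x. a x \<le> a (T x)"
    and two: "\<And>x y. T x = T y \<Longrightarrow> x \<noteq> y \<Longrightarrow> a x + a y \<le> a (T x)"
    and fin: "\<And>e. e > 0 \<Longrightarrow> finite {x. a x \<ge> e}"
    and "a x > 0"
  shows "\<exists>d>0. (T ^^ d) x = x"
proof -
  have "range (\<lambda>k. (T ^^ k) x) \<subseteq> {y. a y \<ge> a x}"
    using mass_mono_funpow[where a = a and T = T] mono by blast
  then have "finite (range (\<lambda>k. (T ^^ k) x))"
    using fin[OF \<open>a x > 0\<close>] finite_subset by blast
  then have "\<not> inj (\<lambda>k. (T ^^ k) x)"
    using finite_imageD by blast
  then have ex: "\<exists>i. \<exists>d>0. (T ^^ (i + d)) x = (T ^^ i) x"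
    unfolding inj_def by (metis less_imp_add_positive linorder_neqE_nat)
  \<comment> \<open>The preperiod of \<open>x\<close>.\<close>
  define i where "i = (LEAST i. \<exists>d>0. (T ^^ (i + d)) x = (T ^^ i) x)"
  obtain d where d: "d > 0" "(T ^^ (i + d)) x = (T ^^ i) x"
    using LeastI_ex[OF ex] by (auto simp: i_def)
  show ?thesis
  proof (cases i)
    case 0
    then show ?thesis using d by auto
  next
    case (Suc i')
    let ?p = "(T ^^ i') x" and ?q = "(T ^^ (i' + d)) x"
    have eq: "T ?p = T ?q"
      using d(2) by (simp add: Suc)
    have "?p \<noteq> ?q"
    proof
      assume "?p = ?q"
      then have "\<exists>d>0. (T ^^ (i' + d)) x = (T ^^ i') x"
        using d(1) by (intro exI[of _ d]) simp
      then have "i \<le> i'"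
        unfolding i_def by (rule Least_le)
      then show False
        by (simp add: Suc)
    qed
    then have "a ?p + a ?q \<le> a (T ?p)"
      using two eq by blast
    moreover have "a (T ?p) \<le> a ((T ^^ (d - 1)) (T ?p))"
      by (rule mass_mono_funpow[where a = a and T = T, OF mono])
    moreover have "(T ^^ (d - 1)) (T ?p) = ?q"
    proof -
      have "(T ^^ (d - 1)) (T ?p) = (T ^^ (d - 1 + Suc i')) x"
        unfolding funpow_add by simp
      also have "d - 1 + Suc i' = i' + d"
        using d(1) by simp
      finally show ?thesis .
    qed
    moreover have "a x \<le> a ?p"
      by (rule mass_mono_funpow[where a = a and T = T, OF mono])
    ultimately show ?thesis
      using \<open>a x > 0\<close> by simp
  qed
qed


section \<open>Cycles and periodic points\<close>

lemma enumerates_cycle_funpow: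
  assumes "enumerates_cycle n l C" "i < l"
  shows "n (Suc i) = (collatz ^^ i) (n 1)"
  using assms(2)
proof (induction i)
  case (Suc i)
  then have "collatz (n (Suc i)) = n (Suc (Suc i))"
    using assms(1) unfolding enumerates_cycle_def by force
  with Suc show ?case by simp
qed simp

lemma enumerates_cycle_return:
  assumes "enumerates_cycle n l C"
  shows "(collatz ^^ l) (n 1) = n 1"
proof -
  obtain l' where l: "l = Suc l'"
    using assms by (cases l) (auto simp: enumerates_cycle_def)
  then show ?thesis
    using assms enumerates_cycle_funpow[OF assms, of l'] by (simp add: enumerates_cycle_def)
qed

lemma enumerates_cycle_eq_orbit:
  assumes "enumerates_cycle n l C"
  shows "C = range (\<lambda>k. (collatz ^^ k) (n 1))"
proof
  have C: "C = n ` {1..l}" and "1 \<le> l"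
    using assms by (auto simp: enumerates_cycle_def)
  show "C \<subseteq> range (\<lambda>k. (collatz ^^ k) (n 1))"
  proof
    fix x assume "x \<in> C"
    then obtain j where "j \<in> {1..l}" "x = n j"
      using C by auto
    moreover from this have "j - 1 < l"
      by auto
    ultimately have "x = (collatz ^^ (j - 1)) (n 1)"
      using enumerates_cycle_funpow[OF assms, of "j - 1"] by simp
    then show "x \<in> range (\<lambda>k. (collatz ^^ k) (n 1))"
      by blast
  qed
  show "range (\<lambda>k. (collatz ^^ k) (n 1)) \<subseteq> C"
  proof clarify
    fix k
    have "(collatz ^^ k) (n 1) = (collatz ^^ (k mod l)) (n 1)"
      by (rule funpow_mod_eq[symmetric, OF enumerates_cycle_return[OF assms]])
    also have "\<dots> = n (Suc (k mod l))"
      using \<open>1 \<le> l\<close> by (intro enumerates_cycle_funpow[OF assms, symmetric]) simp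
    also have "\<dots> \<in> C"
      using \<open>1 \<le> l\<close> by (auto simp: C Suc_le_eq)
    finally show "(collatz ^^ k) (n 1) \<in> C" .
  qed
qed

text \<open>
  A cycle is determined by any of its points, whatever the enumeration; in particular, distinct
  cycles are disjoint.
\<close>

lemma cycle_eq_orbit:
  assumes "is_cycle C" "x \<in> C"
  shows "C = range (\<lambda>k. (collatz ^^ k) x)"
proof -
  obtain n l where enum: "enumerates_cycle n l C"
    using assms(1) by (auto simp: is_cycle_def)
  obtain i where i: "i < l" "x = (collatz ^^ i) (n 1)"
  proof -
    obtain j where "j \<in> {1..l}" "x = n j"
      using enum assms(2) by (auto simp: enumerates_cycle_def)
    moreover from this have "j - 1 < l"
      by auto
    ultimately show ?thesis
      using that[of "j - 1"] enumerates_cycle_funpow[OF enum, of "j - 1"] by simp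
  qed
  have "(collatz ^^ (l - i)) x = n 1"
    using i enumerates_cycle_return[OF enum] by (simp flip: funpow_add[THEN fun_cong, simplified])
  then have "(collatz ^^ k) (n 1) = (collatz ^^ (k + (l - i))) x" for k
    by (simp add: funpow_add)
  moreover have "(collatz ^^ k) x = (collatz ^^ (k + i)) (n 1)" for k
    by (simp add: funpow_add i(2))
  ultimately show ?thesis
    unfolding enumerates_cycle_eq_orbit[OF enum] by (auto simp: image_iff)
qed

lemma cycle_point_periodic:
  assumes "is_cycle C" "x \<in> C"
  shows "\<exists>d>0. (collatz ^^ d) x = x"
proof -
  have "collatz x \<in> C"
    using cycle_eq_orbit[OF assms] by (metis funpow_simps_right(2) funpow_0 comp_apply rangeI)
  then have "x \<in> range (\<lambda>k. (collatz ^^ k) (collatz x))"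
    using cycle_eq_orbit[OF assms(1)] assms(2) by blast
  then obtain k where "x = (collatz ^^ Suc k) x"
    by (auto simp: funpow_swap1)
  then show ?thesis
    by (metis zero_less_Suc)
qed

text \<open>
  With the least period \<open>l\<close> as its length, the orbit of \<open>x\<close> is enumerated without repetition: if
  \<open>n i = n j\<close> with \<open>i < j\<close>, then the \<open>l - j + 1\<close> steps that complete the turn from \<open>n j\<close> to \<open>x\<close> also
  lead from \<open>n i\<close> to \<open>x\<close>, and \<open>x\<close> returns to itself too early.
\<close>

lemma periodic_point_in_cycle:
  assumes "1 \<le> x" "d > 0" "(collatz ^^ d) x = x"
  shows "\<exists>C. is_cycle C \<and> x \<in> C"
proof -
  define l where "l = (LEAST d. d > 0 \<and> (collatz ^^ d) x = x)"
  have l: "l > 0" "(collatz ^^ l) x = x"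
    using LeastI[of "\<lambda>d. d > 0 \<and> (collatz ^^ d) x = x" d] assms by (auto simp: l_def)
  have least: "(collatz ^^ k) x \<noteq> x" if "k < l" "k > 0" for k
    using not_less_Least[of k "\<lambda>d. d > 0 \<and> (collatz ^^ d) x = x"] that by (auto simp: l_def)
  define n where "n j = (collatz ^^ (j - 1)) x" for j
  have ne: "n i \<noteq> n j" if "1 \<le> i" "i < j" "j \<le> l" for i j
  proof
    assume "n i = n j"
    then have "(collatz ^^ (l - (j - 1))) (n i) = (collatz ^^ (l - (j - 1))) (n j)"
      by simp
    then have "(collatz ^^ (l - (j - 1) + (i - 1))) x = (collatz ^^ (l - (j - 1) + (j - 1))) x"
      by (simp add: n_def funpow_add)
    moreover have "l - (j - 1) + (j - 1) = l"
      using that by simp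
    ultimately have "(collatz ^^ (l - (j - 1) + (i - 1))) x = x"
      using l(2) by simp
    moreover have "(collatz ^^ (l - (j - 1) + (i - 1))) x \<noteq> x"
    proof (rule least)
      show "l - (j - 1) + (i - 1) < l" "0 < l - (j - 1) + (i - 1)"
        using that by linarith+
    qed
    ultimately show False
      by contradiction
  qed
  have pos: "1 \<le> (collatz ^^ k) x" for k
  proof (induction k)
    case (Suc k)
    then show ?case
      using collatz_pos by (simp only: funpow.simps comp_apply)
  qed (use assms(1) in simp)
  have "enumerates_cycle n l (n ` {1..l})"
    unfolding enumerates_cycle_def
  proof (intro conjI ballI)
    show "inj_on n {1..l}"
      by (rule linorder_inj_onI') (use ne in auto)
    show "n ` {1..l} \<subseteq> {1..}"
      using pos by (auto simp: n_def)
    show "collatz (n l) = n 1"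
    proof -
      have "collatz (n l) = (collatz ^^ Suc (l - 1)) x"
        by (simp add: n_def)
      then show ?thesis
        using l by (simp add: n_def)
    qed
    fix j assume "j \<in> {1..<l}"
    then show "collatz (n j) = n (j + 1)"
      by (cases j) (auto simp: n_def)
  qed (use l in auto)
  moreover have "x = n 1"
    by (simp add: n_def)
  ultimately show ?thesis
    unfolding is_cycle_def using l(1) by (intro exI[of _ "n ` {1..l}"]) auto
qed


section \<open>Eigenvectors alternate along even cycles and vanish elsewhere\<close>

lemma sum_norm_coord_le_finite: "finite A \<Longrightarrow> (\<Sum>k\<in>A. norm (coord v k)) \<le> norm v"
  unfolding norm_ell1_def by (rule sum_le_suminf) auto

lemma sum_norm_coord_tendsto: "(\<lambda>N. \<Sum>k<N. norm (coord v k)) \<longlonglongrightarrow> norm v"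
  unfolding norm_ell1_def by (rule summable_LIMSEQ) simp

text \<open>
  The defects \<open>(\<Sum>k\<in>collatz_fibre m. \<bar>v k\<bar>) - \<bar>v m\<bar>\<close> are nonnegative by the triangle inequality.
  Since the fibres are disjoint, the defects at all \<open>m < N\<close> add up to at most the norm of \<open>v\<close> minus
  its partial sum up to \<open>N\<close>, and this tends to \<open>0\<close>.
\<close>

lemma eigen_norm_fibre:
  assumes "collatz_op v = - v"
  shows "(\<Sum>k\<in>collatz_fibre m. norm (coord v k)) = norm (coord v m)"
proof -
  let ?a = "\<lambda>k. norm (coord v k)"
  have ge: "?a m \<le> (\<Sum>k\<in>collatz_fibre m. ?a k)" for m
  proof -
    have "?a m = norm (\<Sum>k\<in>collatz_fibre m. coord v k)"
      using assms by (simp add: eigen_iff_fibre_sums)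
    also have "\<dots> \<le> (\<Sum>k\<in>collatz_fibre m. ?a k)"
      by (rule norm_sum)
    finally show ?thesis .
  qed
  have tail: "(\<Sum>k\<in>collatz_fibre m. ?a k) - ?a m \<le> norm v - (\<Sum>k<N. ?a k)" if "m < N" for N
  proof -
    have "(\<Sum>k\<in>collatz_fibre m. ?a k) - ?a m
        \<le> (\<Sum>m<N. (\<Sum>k\<in>collatz_fibre m. ?a k) - ?a m)"
      using that ge by (intro member_le_sum) (simp_all del: One_nat_def)
    also have "\<dots> = (\<Sum>k\<in>(\<Union>m<N. collatz_fibre m). ?a k) - (\<Sum>k<N. ?a k)"
      unfolding sum_subtractf by (subst sum.UNION_disjoint) (auto simp: finite_collatz_fibre)
    also have "\<dots> \<le> norm v - (\<Sum>k<N. ?a k)"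
      by (intro diff_right_mono sum_norm_coord_le_finite) (auto simp: finite_collatz_fibre)
    finally show ?thesis .
  qed
  have "(\<lambda>N. norm v - (\<Sum>k<N. ?a k)) \<longlonglongrightarrow> norm v - norm v"
    by (intro tendsto_intros sum_norm_coord_tendsto)
  then have "(\<Sum>k\<in>collatz_fibre m. ?a k) - ?a m \<le> norm v - norm v"
    by (rule LIMSEQ_le_const) (use tail in \<open>auto intro!: exI[of _ "Suc m"]\<close>)
  with ge[of m] show ?thesis
    by simp
qed

lemma eigen_mass_mono:
  assumes "collatz_op v = - v"
  shows "norm (coord v k) \<le> norm (coord v (collatz k))"
proof (cases "k = 0")
  case False
  then have "norm (coord v k) \<le> (\<Sum>k\<in>collatz_fibre (collatz k). norm (coord v k))"
    by (intro member_le_sum) (auto simp: finite_collatz_fibre)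
  then show ?thesis
    by (simp add: eigen_norm_fibre[OF assms])
qed simp

lemma eigen_mass_two_preimages:
  assumes "collatz_op v = - v" "collatz p = collatz q" "p \<noteq> q"
  shows "norm (coord v p) + norm (coord v q) \<le> norm (coord v (collatz p))"
proof (cases "p = 0 \<or> q = 0")
  case True
  then show ?thesis
    using eigen_mass_mono[OF assms(1), of p] eigen_mass_mono[OF assms(1), of q] assms(2) by auto
next
  case False
  have "norm (coord v p) + norm (coord v q) = (\<Sum>k\<in>{p, q}. norm (coord v k))"
    using assms(3) by simp
  also have "\<dots> \<le> (\<Sum>k\<in>collatz_fibre (collatz p). norm (coord v k))"
    using False assms(2) by (intro sum_mono2) (auto simp: finite_collatz_fibre)
  finally show ?thesis
    by (simp add: eigen_norm_fibre[OF assms(1)])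
qed

lemma finite_large_coords:
  assumes "e > 0"
  shows "finite {k. norm (coord v k) \<ge> e}"
proof -
  have "(\<lambda>k. norm (coord v k)) \<longlonglongrightarrow> 0"
    by (rule summable_LIMSEQ_zero) simp
  then have "\<forall>\<^sub>F k in sequentially. norm (coord v k) < e"
    using assms by (rule order_tendstoD)
  then show ?thesis
    by (simp add: eventually_cofinite not_less flip: cofinite_eq_sequentially)
qed

lemma eigen_support_periodic:
  assumes "collatz_op v = - v" "coord v k \<noteq> 0"
  shows "\<exists>d>0. (collatz ^^ d) k = k"
  by (rule conserved_mass_periodic[where a = "\<lambda>k. norm (coord v k)"])
     (use assms eigen_mass_mono eigen_mass_two_preimages finite_large_coords in auto)

text \<open>
  Mass does not decrease from \<^term>\<open>collatz q\<close> back to \<open>q\<close>, so \<open>q\<close> already accounts for all the mass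
  of its image and every other preimage has mass zero. The fibre sum is then the single term at \<open>q\<close>.
\<close>

lemma eigen_alternates_at_periodic:
  assumes eigen: "collatz_op v = - v" and "d > 0" "(collatz ^^ d) q = q"
  shows "coord v (collatz q) = - coord v q"
proof (cases "q = 0")
  case False
  have "norm (coord v (collatz q)) \<le> norm (coord v ((collatz ^^ (d - 1)) (collatz q)))"
    by (rule mass_mono_funpow[where a = "\<lambda>k. norm (coord v k)", OF eigen_mass_mono[OF eigen]])
  also have "(collatz ^^ (d - 1)) (collatz q) = q"
    using assms(2,3) by (cases d) (simp_all add: funpow_swap1)
  finally have le: "norm (coord v (collatz q)) \<le> norm (coord v q)" .
  have "coord v p = 0" if "p \<in> collatz_fibre (collatz q) - {q}" for p
    using eigen_mass_two_preimages[OF eigen, of p q] that le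
    by (auto simp flip: norm_le_zero_iff)
  then have "(\<Sum>k\<in>collatz_fibre (collatz q). coord v k) = (\<Sum>k\<in>{q}. coord v k)"
    using False by (intro sum.mono_neutral_right) (auto simp: finite_collatz_fibre)
  then have "- coord v (collatz q) = coord v q"
    using eigen by (simp add: eigen_iff_fibre_sums)
  then show ?thesis
    by (metis minus_minus)
qed (simp add: collatz_def)

lemma eigen_on_cycle:
  assumes eigen: "collatz_op v = - v" and enum: "enumerates_cycle n l C"
  shows "\<And>j. j \<in> {1..l} \<Longrightarrow> coord v (n j) = (- 1) ^ (j - 1) * coord v (n 1)"
    and "odd l \<Longrightarrow> coord v (n 1) = 0"
proof -
  have step: "coord v (collatz q) = - coord v q" if "q \<in> C" for q
    using eigen_alternates_at_periodic[OF eigen] cycle_point_periodic[of C q] enum that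
    by (auto simp: is_cycle_def)
  have *: "coord v (n (Suc i)) = (- 1) ^ i * coord v (n 1)" if "i < l" for i
    using that
  proof (induction i)
    case (Suc i)
    then have "collatz (n (Suc i)) = n (Suc (Suc i))" "n (Suc i) \<in> C"
      using enum by (auto simp: enumerates_cycle_def)
    with step[of "n (Suc i)"] Suc show ?case by simp
  qed simp
  show "coord v (n j) = (- 1) ^ (j - 1) * coord v (n 1)" if "j \<in> {1..l}" for j
    using *[of "j - 1"] that by (cases j) auto
  assume "odd l"
  have "collatz (n l) = n 1" "n l \<in> C" "1 \<le> l"
    using enum by (auto simp: enumerates_cycle_def)
  then have "coord v (n 1) = - ((- 1) ^ (l - 1) * coord v (n 1))"
    using step[of "n l"] *[of "l - 1"] by simp
  then have "2 * coord v (n 1) = 0"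
    using \<open>odd l\<close> \<open>1 \<le> l\<close> by (simp add: eq_neg_iff_add_eq_0)
  then show "coord v (n 1) = 0"
    by simp
qed

text \<open>
  The multiple of the cycle vector is the restriction of \<open>v\<close> to the cycle. This includes the odd
  cycles, where both sides vanish.
\<close>

lemma eigen_cycle_component:
  fixes v :: "'a::{real_normed_field, banach} ell1"
  assumes eigen: "collatz_op v = - v" and enum: "enumerates_cycle n l C"
  shows "coord v (n 1) * coord (cycle_vec n l) k = (if k \<in> C then coord v k else 0)"
proof (cases "k \<in> C")
  case True
  then obtain j where j: "j \<in> {1..l}" "k = n j"
    using enum by (auto simp: enumerates_cycle_def)
  then have "coord v k = (- 1) ^ (j - 1) * coord v (n 1)"
    using eigen_on_cycle(1)[OF eigen enum j(1)] by simp
  then show ?thesis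
    using True j coord_cycle_vec_enum[OF enum j(1), where 'a = 'a] by (simp add: mult.commute)
next
  case False
  then show ?thesis
    using coord_cycle_vec_outside[OF enum False, where 'a = 'a] by simp
qed


section \<open>The eigenspace\<close>

lemma norm_le_tail:
  fixes u v :: "'a::real_normed_field ell1"
  assumes "\<And>k. k < N \<Longrightarrow> coord u k = 0" "\<And>k. norm (coord u k) \<le> norm (coord v k)"
  shows "norm u \<le> norm v - (\<Sum>k<N. norm (coord v k))"
proof -
  have head: "(\<Sum>k<N. norm (coord u k)) = 0"
    using assms(1) by (intro sum.neutral) simp
  have shift: "summable (\<lambda>k. norm (coord x (k + N)))" for x :: "'a ell1"
    by (rule summable_ignore_initial_segment[OF summable_norm_coord])
  have "norm u = (\<Sum>k. norm (coord u (k + N)))"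
    using suminf_split_initial_segment[OF summable_norm_coord, of u N] head
    by (simp add: norm_ell1_def)
  also have "\<dots> \<le> (\<Sum>k. norm (coord v (k + N)))"
    by (rule suminf_le[OF assms(2) shift shift])
  also have "\<dots> = norm v - (\<Sum>k<N. norm (coord v k))"
    unfolding norm_ell1_def
    by (rule suminf_minus_initial_segment[OF summable_norm_coord])
  finally show ?thesis .
qed

theorem theorem6p9:
  fixes I :: "nat set" and C :: "nat \<Rightarrow> nat set" and n :: "nat \<Rightarrow> nat \<Rightarrow> nat"
  assumes "bij_betw C I {A. is_cycle A}"
    and "\<And>i. i \<in> I \<Longrightarrow> enumerates_cycle (n i) (card (C i)) (C i)"
  shows "{v :: 'a::{real_normed_field, banach} ell1. collatz_op v = - v} =
         closure (ell1.span {cycle_vec (n i) (card (C i)) |i. i \<in> I \<and> even (card (C i))})"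
    (is "?E = closure (ell1.span ?B)")
proof
  have "?B \<subseteq> ?E"
    using even_cycle_vec_eigen assms(2) by blast
  then have "ell1.span ?B \<subseteq> ?E"
    by (intro ell1.span_minimal subspace_eigenspace)
  then show "closure (ell1.span ?B) \<subseteq> ?E"
    by (intro closure_minimal closed_eigenspace)
next
  have unique: "i = j" if "i \<in> I" "j \<in> I" "k \<in> C i" "k \<in> C j" for i j k
  proof -
    have "is_cycle (C i)" "is_cycle (C j)"
      using assms(1) that by (auto simp: bij_betw_def)
    then have "C i = C j"
      using cycle_eq_orbit that(3,4) by blast
    then show ?thesis
      using assms(1) that(1,2) by (auto simp: bij_betw_def inj_on_def)
  qed
  show "?E \<subseteq> closure (ell1.span ?B)"
  proof
    fix v :: "'a ell1" assume "v \<in> ?E"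
    then have eigen: "collatz_op v = - v"
      by simp
    show "v \<in> closure (ell1.span ?B)"
      unfolding closure_approachable
    proof (intro allI impI)
      fix e :: real assume "e > 0"
      then obtain N where N: "norm v - e < (\<Sum>k<N. norm (coord v k))"
        using order_tendstoD(1)[OF sum_norm_coord_tendsto, of "norm v - e" v]
        by (auto simp: eventually_sequentially)
      \<comment> \<open>The cycles in \<open>F\<close> are taken whole, with their points beyond \<open>N\<close>: \<open>w\<close> is a restriction of
        \<open>v\<close> that agrees with \<open>v\<close> below \<open>N\<close>, so the error is at most the tail of \<open>v\<close>.\<close>
      define F where "F = {i \<in> I. even (card (C i)) \<and> (\<exists>k<N. k \<in> C i)}"
      define w where "w = (\<Sum>i\<in>F. coord v (n i 1) *\<^sub>E cycle_vec (n i) (card (C i)))"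
      \<comment> \<open>\<open>F\<close> is finite because each \<open>k < N\<close> lies on at most one cycle.\<close>
      have "finite {i \<in> I. k \<in> C i}" for k
      proof (cases "\<exists>i\<in>I. k \<in> C i")
        case True
        then obtain i where "i \<in> I" "k \<in> C i" by blast
        then have "{i \<in> I. k \<in> C i} \<subseteq> {i}"
          using unique by blast
        then show ?thesis
          by (rule finite_subset) simp
      next
        case False
        then have "{i \<in> I. k \<in> C i} = {}" by blast
        then show ?thesis by (simp only: finite.emptyI)
      qed
      then have "finite (\<Union>k<N. {i \<in> I. k \<in> C i})"
        by blast
      then have "finite F"
        by (rule finite_subset[rotated]) (auto simp: F_def)
      have w: "coord w k = (\<Sum>i\<in>F. if k \<in> C i then coord v k else 0)" for k
        unfolding w_def coord_sum coord_scale
        by (intro sum.cong refl eigen_cycle_component[OF eigen]) (auto simp: F_def assms(2))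
      have w_in: "coord w k = coord v k" if "i \<in> F" "k \<in> C i" for i k
      proof -
        have "coord w k = (\<Sum>j\<in>F. if j = i then coord v k else 0)"
          unfolding w using unique that by (intro sum.cong) (auto simp: F_def)
        then show ?thesis
          using \<open>finite F\<close> that(1) by simp
      qed
      have w_out: "coord w k = 0" if "\<And>i. i \<in> F \<Longrightarrow> k \<notin> C i" for k
        unfolding w using that by (intro sum.neutral) auto
      have "norm (v - w) \<le> norm v - (\<Sum>k<N. norm (coord v k))"
      proof (rule norm_le_tail)
        show "norm (coord (v - w) k) \<le> norm (coord v k)" for k
          by (cases "\<exists>i\<in>F. k \<in> C i") (use w_in w_out in auto)
        fix k assume "k < N"
        show "coord (v - w) k = 0"
        proof (cases "coord v k = 0")
          case True
          then have "coord w k = 0"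
            unfolding w by (intro sum.neutral) simp
          with True show ?thesis
            by simp
        next
          case False
          then obtain d where "d > 0" "(collatz ^^ d) k = k"
            using eigen_support_periodic[OF eigen] by blast
          moreover have "1 \<le> k"
            using False by (cases k) auto
          ultimately obtain A where "is_cycle A" "k \<in> A"
            using periodic_point_in_cycle by blast
          then obtain i where i: "i \<in> I" "k \<in> C i"
            using assms(1) by (auto simp: bij_betw_def)
          have "even (card (C i))"
          proof (rule ccontr)
            assume "odd (card (C i))"
            then have "coord v (n i 1) = 0"
              using eigen_on_cycle(2)[OF eigen assms(2)[OF i(1)]] by blast
            then show False
              using eigen_cycle_component[OF eigen assms(2)[OF i(1)], of k] i(2) False by simp
          qed
          then have "i \<in> F"
            using i \<open>k < N\<close> by (auto simp: F_def)
          then show ?thesis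
            using w_in i(2) by simp
        qed
      qed
      then have "dist w v < e"
        using N by (simp add: dist_norm norm_minus_commute)
      moreover have "w \<in> ell1.span ?B"
        unfolding w_def
        by (intro ell1.span_sum ell1.span_scale ell1.span_base) (auto simp: F_def)
      ultimately show "\<exists>y\<in>ell1.span ?B. dist y v < e"
        by blast
    qed
  qed
qed

end
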